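(* For a band $X$ the following conditions are equivalent: (1) $X$ is a finite linear semilattice; (2) the semigroup $\upsilon(X)$ is commutative; (3) the semigroup $N_2(X)$ is commutative; (4) the semigroup $\lambda(X)$ is commutative and $(1,2)$-Clifford.
   Context: A band is a semigroup with $xx=x$ for all $x$. A semilattice is a commutative band. A semigroup $S$ is linear if $xy\in\{x,y\}$ for all $x,y\in S$. A semigroup $S$ is $(1,2)$-Clifford if for every $x\in S$ the equality $x^2=x^3$ implies $x=x^2$. For a set $X$, an upfamily on $X$ is a non-empty family $\mathcal F$ of non-empty subsets of $X$ such that $A\in\mathcal F$ and $A\subset B\subset X$ imply $B\in\mathcal F$; $\upsilon(X)$ is the set of all upfamilies on $X$. For a family $\mathcal B$ of subsets of $X$, $\langle\mathcal B\rangle=\{A\subset X:\exists B\in\mathcal B,\ B\subset A\}$. An upfamily $\mathcal A$ is linked if $A\cap B\neq\emptyset$ for all $A,B\in\mathcal A$; maximal linked if it is linked and is not properly contained in another linked upfamily. $N_2(X)$ and $\lambda(X)$ are the sets of all linked upfamilies and of all maximal linked upfamilies on $X$, respectively. If $X$ is a semigroup, the operation of $X$ is extended to $\upsilon(X)$ by $\mathcal U*\mathcal V=\big\langle\bigcup_{x\in U}xV_x: U\in\mathcal U,\ (V_x)_{x\in U}\in\mathcal V^U\big\rangle$. This makes $\upsilon(X)$ a semigroup, with $N_2(X)$ and $\lambda(X)$ as subsemigroups. *)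

theory Defs
  imports Main
begin

section \<open>Semigroups on a carrier set\<close>

text \<open>
  A semigroup is given by a carrier set together with a binary operation on the ambient type:
  the locales of HOL whose carrier is a whole type do not cover the semigroups of upfamilies
  below, which live on proper subsets of the type of all set families.
\<close>

definition semigroup_on :: "'a set \<Rightarrow> ('a \<Rightarrow> 'a \<Rightarrow> 'a) \<Rightarrow> bool" where
  "semigroup_on S f \<longleftrightarrow>
     (\<forall>x\<in>S. \<forall>y\<in>S. f x y \<in> S) \<and>
     (\<forall>x\<in>S. \<forall>y\<in>S. \<forall>z\<in>S. f (f x y) z = f x (f y z))"

definition commutative_on :: "'a set \<Rightarrow> ('a \<Rightarrow> 'a \<Rightarrow> 'a) \<Rightarrow> bool" where
  "commutative_on S f \<longleftrightarrow> (\<forall>x\<in>S. \<forall>y\<in>S. f x y = f y x)"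

definition band_on :: "'a set \<Rightarrow> ('a \<Rightarrow> 'a \<Rightarrow> 'a) \<Rightarrow> bool" where
  "band_on S f \<longleftrightarrow> semigroup_on S f \<and> (\<forall>x\<in>S. f x x = x)"

definition semilattice_on :: "'a set \<Rightarrow> ('a \<Rightarrow> 'a \<Rightarrow> 'a) \<Rightarrow> bool" where
  "semilattice_on S f \<longleftrightarrow> band_on S f \<and> commutative_on S f"

definition linear_on :: "'a set \<Rightarrow> ('a \<Rightarrow> 'a \<Rightarrow> 'a) \<Rightarrow> bool" where
  "linear_on S f \<longleftrightarrow> (\<forall>x\<in>S. \<forall>y\<in>S. f x y \<in> {x, y})"

text \<open>The $(1,2)$-Clifford property: $x^2 = x^3$ implies $x = x^2$.\<close>

definition clifford12_on :: "'a set \<Rightarrow> ('a \<Rightarrow> 'a \<Rightarrow> 'a) \<Rightarrow> bool" where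
  "clifford12_on S f \<longleftrightarrow> (\<forall>x\<in>S. f x x = f (f x x) x \<longrightarrow> x = f x x)"


section \<open>Upfamilies\<close>

definition upfamily_on :: "'a set \<Rightarrow> 'a set set \<Rightarrow> bool" where
  "upfamily_on X F \<longleftrightarrow>
     F \<noteq> {} \<and> (\<forall>A\<in>F. A \<noteq> {} \<and> A \<subseteq> X) \<and>
     (\<forall>A B. A \<in> F \<and> A \<subseteq> B \<and> B \<subseteq> X \<longrightarrow> B \<in> F)"

definition upfamilies :: "'a set \<Rightarrow> 'a set set set" where
  "upfamilies X = {F. upfamily_on X F}"

definition upclosure :: "'a set \<Rightarrow> 'a set set \<Rightarrow> 'a set set" where
  "upclosure X \<B> = {A. A \<subseteq> X \<and> (\<exists>B\<in>\<B>. B \<subseteq> A)}"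

definition linked :: "'a set set \<Rightarrow> bool" where
  "linked \<A> \<longleftrightarrow> (\<forall>A\<in>\<A>. \<forall>B\<in>\<A>. A \<inter> B \<noteq> {})"

definition linked_upfamilies :: "'a set \<Rightarrow> 'a set set set" where
  "linked_upfamilies X = {\<A> \<in> upfamilies X. linked \<A>}"

definition max_linked_upfamilies :: "'a set \<Rightarrow> 'a set set set" where
  "max_linked_upfamilies X =
     {\<A> \<in> linked_upfamilies X. \<not> (\<exists>\<B> \<in> linked_upfamilies X. \<A> \<subset> \<B>)}"

text \<open>
  The extension of the operation \<open>f\<close> of \<open>X\<close> to upfamilies. A family $(V_x)_{x \in U}$ is
  a total function \<open>V\<close> of which only the values on \<open>U\<close> matter.
\<close>

definition upfamily_mult ::
  "'a set \<Rightarrow> ('a \<Rightarrow> 'a \<Rightarrow> 'a) \<Rightarrow> 'a set set \<Rightarrow> 'a set set \<Rightarrow> 'a set set" where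
  "upfamily_mult X f \<U> \<V> =
     upclosure X {\<Union>x\<in>U. f x ` V x | U V. U \<in> \<U> \<and> (\<forall>x\<in>U. V x \<in> \<V>)}"

end

theory Submission
  imports Defs "HOL-Library.Ramsey"
begin

text \<open>
  The product of upfamilies is best read from its members: \<open>A\<close> belongs to \<open>\<U> * \<V>\<close> if and only
  if \<open>\<U>\<close>-many \<open>x\<close> have the property that \<open>\<V>\<close>-many \<open>y\<close> satisfy \<open>x y \<in> A\<close>
  (\<open>mem_upfamily_mult_iff\<close>). Commutativity of the product thus means that the two quantifiers
  ``\<open>\<U>\<close>-many'' and ``\<open>\<V>\<close>-many'' can be exchanged.

  Let \<open>X\<close> be a finite linear semilattice, ordered by \<open>x \<le> y\<close> iff \<open>x y = x\<close>, so that the operation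
  is the minimum. Put \<open>L\<^sub>t = {x \<in> A. x \<le> t}\<close> and \<open>H\<^sub>t = A \<union> {x. t \<le> x}\<close>. Then \<open>A \<in> \<U> * \<V>\<close>
  holds exactly if for some \<open>t \<in> A\<close> one of \<open>\<U>\<close>, \<open>\<V>\<close> contains \<open>L\<^sub>t\<close> and the other one contains
  \<open>H\<^sub>t\<close> (\<open>mem_chain_mult_iff\<close>). This condition is visibly symmetric, so \<open>\<upsilon>(X)\<close> and all its
  subsemigroups are commutative. For \<open>\<U> = \<V>\<close> it reduces to \<open>A \<in> \<U>\<close>, so \<open>\<upsilon>(X)\<close> is even a
  band, and bands are trivially (1,2)-Clifford.

  For the converse, \<open>x\<close> is sent to the principal ultrafilter at \<open>x\<close>; these are maximal linked and
  multiply like the elements of \<open>X\<close>, so commutativity of \<open>\<lambda>(X)\<close> makes \<open>X\<close> a semilattice. If \<open>X\<close>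
  is not linear, it contains \<open>x, y\<close> for which \<open>z = x y\<close> is a third element, and on
  \<open>{x, y, z}\<close> the two-out-of-three majority family \<open>M\<close> is maximal linked. Its square is the
  principal ultrafilter at \<open>z\<close> and equals its cube, which refutes the (1,2)-Clifford property
  (\<open>linear_of_clifford_max_linked\<close>); moreover \<open>M\<close> does not commute with the linked upfamily of
  all supersets of \<open>{x, y}\<close> (\<open>linear_of_commutative_linked\<close>).

  Finally, an infinite linear \<open>X\<close> contains an infinite sequence on which the operation always
  returns the earlier or always the later of two terms. Let \<open>\<U>\<close> and \<open>\<V>\<close> be maximal linked
  upfamilies containing all tails of the even and of the odd subsequence. In the first case
  \<open>\<U> * \<V>\<close> contains the set of even terms and \<open>\<V> * \<U>\<close> that of odd terms, in the second case it
  is the other way round. The two products are linked and the two sets are disjoint, so the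
  products differ and \<open>\<lambda>(X)\<close> is not commutative (\<open>finite_of_commutative_max_linked\<close>).
\<close>

section \<open>Products of upfamilies\<close>

lemma upfamilyD:
  assumes "F \<in> upfamilies X"
  shows "F \<noteq> {}" "A \<in> F \<Longrightarrow> A \<noteq> {}" "A \<in> F \<Longrightarrow> A \<subseteq> X"
    "A \<in> F \<Longrightarrow> A \<subseteq> B \<Longrightarrow> B \<subseteq> X \<Longrightarrow> B \<in> F"
  using assms unfolding upfamilies_def upfamily_on_def by blast+

lemma upfamily_multI:
  assumes A: "A \<subseteq> X" and B: "B \<in> U"
    and C: "\<And>x. x \<in> B \<Longrightarrow> \<exists>C\<in>V. \<forall>y\<in>C. f x y \<in> A"
  shows "A \<in> upfamily_mult X f U V"
proof -
  obtain W where "\<forall>x\<in>B. W x \<in> V \<and> (\<forall>y\<in>W x. f x y \<in> A)"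
    using C by metis
  then have "(\<Union>x\<in>B. f x ` W x) \<subseteq> A" "\<forall>x\<in>B. W x \<in> V" by auto
  then show ?thesis using A B unfolding upfamily_mult_def upclosure_def by blast
qed

text \<open>
  By monotonicity, the best choice of the sets \<open>V\<^sub>x\<close> for a given target \<open>A\<close> is the largest
  one, \<open>V\<^sub>x = {y. x y \<in> A}\<close>, and then \<open>U\<close> may be taken to consist of all \<open>x\<close> for which this set
  belongs to \<open>\<V>\<close>. This removes the choice of a family from the definition of the product.
\<close>

lemma mem_upfamily_mult_iff:
  assumes U: "U \<in> upfamilies X" and V: "V \<in> upfamilies X"
  shows "A \<in> upfamily_mult X f U V \<longleftrightarrow>
    A \<subseteq> X \<and> {x \<in> X. {y \<in> X. f x y \<in> A} \<in> V} \<in> U" (is "?l \<longleftrightarrow> ?r")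
proof
  assume ?l
  then obtain B W where A: "A \<subseteq> X" and B: "B \<in> U" and W: "\<forall>x\<in>B. W x \<in> V"
    and sub: "(\<Union>x\<in>B. f x ` W x) \<subseteq> A"
    unfolding upfamily_mult_def upclosure_def by (smt (verit) mem_Collect_eq)
  have "B \<subseteq> {x \<in> X. {y \<in> X. f x y \<in> A} \<in> V}"
  proof
    fix x assume x: "x \<in> B"
    have "W x \<subseteq> {y \<in> X. f x y \<in> A}"
      using x W sub upfamilyD(3)[OF V] by blast
    then have "{y \<in> X. f x y \<in> A} \<in> V"
      using x W upfamilyD(4)[OF V, of "W x"] by blast
    then show "x \<in> {x \<in> X. {y \<in> X. f x y \<in> A} \<in> V}"
      using x B upfamilyD(3)[OF U] by blast
  qed
  then have "{x \<in> X. {y \<in> X. f x y \<in> A} \<in> V} \<in> U"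
    using upfamilyD(4)[OF U B] by blast
  with A show ?r by blast
next
  assume r: ?r
  show ?l
  proof (rule upfamily_multI)
    show "A \<subseteq> X" "{x \<in> X. {y \<in> X. f x y \<in> A} \<in> V} \<in> U" using r by blast+
    fix x assume "x \<in> {x \<in> X. {y \<in> X. f x y \<in> A} \<in> V}"
    then show "\<exists>C\<in>V. \<forall>y\<in>C. f x y \<in> A"
      by (intro bexI[of _ "{y \<in> X. f x y \<in> A}"]) auto
  qed
qed


section \<open>Finite chains\<close>

lemma finite_total_trans_has_greatest:
  assumes "finite S" "S \<noteq> {}" "S \<subseteq> X"
    and total: "\<And>x y. x \<in> X \<Longrightarrow> y \<in> X \<Longrightarrow> R x y \<or> R y x"
    and trans: "\<And>x y z. \<lbrakk>x \<in> X; y \<in> X; z \<in> X; R x y; R y z\<rbrakk> \<Longrightarrow> R x z"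
  shows "\<exists>m\<in>S. \<forall>y\<in>S. R y m"
  using assms(1-3)
proof (induction S rule: finite_ne_induct)
  case (singleton x)
  then show ?case using total by blast
next
  case (insert x S)
  then obtain m where m: "m \<in> S" "\<forall>y\<in>S. R y m" by blast
  have X: "x \<in> X" "m \<in> X" "S \<subseteq> X" using insert.prems m by auto
  show ?case
  proof (cases "R x m")
    case True
    then show ?thesis using m by blast
  next
    case False
    then have "R m x" using total X by blast
    then have "\<forall>y\<in>S. R y x" using trans m X by blast
    moreover have "R x x" using total X by blast
    ultimately show ?thesis by blast
  qed
qed

text \<open>
  Order \<open>X\<close> by \<open>x \<le> y\<close> iff \<open>x y = x\<close> and put \<open>Q\<^sub>x = {y. x y \<in> A}\<close>. For \<open>x \<in> A\<close> the set \<open>Q\<^sub>x\<close>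
  consists of the members of \<open>A\<close> and of all elements above \<open>x\<close>; for \<open>x \<notin> A\<close> it consists of the
  members of \<open>A\<close> below \<open>x\<close>. So \<open>Q\<^sub>x\<close> contains \<open>A\<close> and shrinks as \<open>x\<close> grows within \<open>A\<close>, and it
  is contained in \<open>A\<close> and grows with \<open>x\<close> outside \<open>A\<close>. The condition \<open>Q\<^sub>x \<in> \<V>\<close> is
  therefore a threshold condition on \<open>x\<close>, and the threshold can be chosen in \<open>A\<close> because \<open>X\<close> is
  finite. The two disjuncts arise from the cases \<open>A \<in> \<V>\<close> and \<open>A \<notin> \<V>\<close>. The point of the
  right-hand side is that it is symmetric in \<open>U\<close> and \<open>V\<close>.
\<close>

lemma mem_chain_mult_iff:
  assumes semil: "semilattice_on X f" and lin: "linear_on X f" and fin: "finite X"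
    and U: "U \<in> upfamilies X" and V: "V \<in> upfamilies X"
  shows "A \<in> upfamily_mult X f U V \<longleftrightarrow> A \<subseteq> X \<and>
    (\<exists>t\<in>A. ({x \<in> A. f x t = x} \<in> V \<and> A \<union> {x \<in> X. f t x = t} \<in> U) \<or>
            ({x \<in> A. f x t = x} \<in> U \<and> A \<union> {x \<in> X. f t x = t} \<in> V))"
    (is "?l \<longleftrightarrow> A \<subseteq> X \<and> (\<exists>t\<in>A. (?L t \<in> V \<and> ?H t \<in> U) \<or> (?L t \<in> U \<and> ?H t \<in> V))")
proof -
  have com: "f x y = f y x" if "x \<in> X" "y \<in> X" for x y
    using semil that unfolding semilattice_on_def commutative_on_def by blast
  have assoc: "f (f x y) z = f x (f y z)" if "x \<in> X" "y \<in> X" "z \<in> X" for x y z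
    using semil that unfolding semilattice_on_def band_on_def semigroup_on_def by blast
  have lin': "f x y = x \<or> f x y = y" if "x \<in> X" "y \<in> X" for x y
    using lin that unfolding linear_on_def by blast
  have total: "f x y = x \<or> f y x = y" if "x \<in> X" "y \<in> X" for x y
    using lin' com that by metis
  have trans: "f x z = x" if "x \<in> X" "y \<in> X" "z \<in> X" "f x y = x" "f y z = y" for x y z
    using assoc that by metis
  have greatest: "\<exists>m\<in>S. \<forall>y\<in>S. f y m = y" if "S \<noteq> {}" "S \<subseteq> X" for S
  proof (rule finite_total_trans_has_greatest[where X=X])
    show "finite S" using finite_subset[OF that(2) fin] .
    show "f x y = x \<or> f y x = y" if "x \<in> X" "y \<in> X" for x y
      using total that by blast
    show "f x z = x" if "x \<in> X" "y \<in> X" "z \<in> X" "f x y = x" "f y z = y" for x y z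
      using trans[OF that] .
  qed (use that in blast)+
  have least: "\<exists>m\<in>S. \<forall>y\<in>S. f m y = m" if "S \<noteq> {}" "S \<subseteq> X" for S
  proof (rule finite_total_trans_has_greatest[where X=X])
    show "finite S" using finite_subset[OF that(2) fin] .
    show "f y x = y \<or> f x y = x" if "x \<in> X" "y \<in> X" for x y
      using total that by blast
    show "f z x = z" if "x \<in> X" "y \<in> X" "z \<in> X" "f y x = y" "f z y = z" for x y z
      using trans[OF that(3,2,1,5,4)] .
  qed (use that in blast)+
  show ?thesis
  proof (intro iffI conjI)
    assume l: ?l
    let ?Q = "\<lambda>x. {y \<in> X. f x y \<in> A}"
    let ?S = "{x \<in> X. ?Q x \<in> V}"
    from l have A: "A \<subseteq> X" and S: "?S \<in> U"
      using mem_upfamily_mult_iff[OF U V] by auto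
    show "A \<subseteq> X" by fact
    show "\<exists>t\<in>A. (?L t \<in> V \<and> ?H t \<in> U) \<or> (?L t \<in> U \<and> ?H t \<in> V)"
    proof (cases "A \<in> V")
      case True
      \<comment> \<open>Here all of \<open>A\<close> lies in \<open>?S\<close>, so only the elements outside \<open>A\<close> impose a threshold:
        it is the least \<open>t \<in> A\<close> with \<open>?L t \<in> V\<close>.\<close>
      have L_of_bounded: "\<exists>t\<in>D. ?L t \<in> V" if "D \<in> V" "D \<subseteq> A" for D
      proof -
        have "D \<noteq> {}" "D \<subseteq> X" using upfamilyD(2,3)[OF V \<open>D \<in> V\<close>] .
        then obtain t where "t \<in> D" "\<forall>y\<in>D. f y t = y"
          using greatest[of D] by blast
        then have "D \<subseteq> ?L t" using that by blast
        then have "?L t \<in> V" using upfamilyD(4)[OF V \<open>D \<in> V\<close>] A by blast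
        then show ?thesis using \<open>t \<in> D\<close> by blast
      qed
      have "{t \<in> A. ?L t \<in> V} \<noteq> {}" using L_of_bounded[OF True] by blast
      then obtain t where t: "t \<in> A" "?L t \<in> V"
        and tmin: "\<And>s. s \<in> A \<Longrightarrow> ?L s \<in> V \<Longrightarrow> f t s = t"
        using least[of "{t \<in> A. ?L t \<in> V}"] A by blast
      have "?S \<subseteq> ?H t"
      proof
        fix x assume x: "x \<in> ?S"
        show "x \<in> ?H t"
        proof (cases "x \<in> A")
          case False
          then have Q_eq: "f x y = y" if "y \<in> ?Q x" for y
            using that x lin'[of x y] by auto
          then have Q: "?Q x \<subseteq> A" "\<And>y. y \<in> ?Q x \<Longrightarrow> f y x = y"
            using x com by force+
          then obtain s where s: "s \<in> ?Q x" "?L s \<in> V"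
            using L_of_bounded[of "?Q x"] x by blast
          then have "f t s = t" "f s x = s" using tmin Q by blast+
          then have "f t x = t" using trans[of t s x] t s x A by blast
          then show ?thesis using x by blast
        qed blast
      qed
      then have "?H t \<in> U" using upfamilyD(4)[OF U S] A by blast
      then show ?thesis using t by blast
    next
      case False
      \<comment> \<open>Here no element outside \<open>A\<close> lies in \<open>?S\<close>, and the threshold is the greatest element
        of \<open>?S\<close>.\<close>
      have SA: "?S \<subseteq> A"
      proof (rule ccontr)
        assume "\<not> ?S \<subseteq> A"
        then obtain x where x: "x \<in> ?S" "x \<notin> A" by blast
        then have "?Q x \<subseteq> A" using lin'[of x] by force
        then show False using x False A upfamilyD(4)[OF V, of "?Q x" A] by blast
      qed
      then obtain t where t: "t \<in> ?S" "\<forall>y\<in>?S. f y t = y"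
        using greatest[of ?S] upfamilyD(2)[OF U S] by blast
      have "?S \<subseteq> ?L t" using t SA by blast
      then have L: "?L t \<in> U" using upfamilyD(4)[OF U S] A by blast
      have "?Q t \<subseteq> ?H t" using t(1) lin'[of t] by force
      then have "?H t \<in> V" using t A upfamilyD(4)[OF V, of "?Q t" "?H t"] by blast
      then show ?thesis using t L SA by blast
    qed
  next
    assume r: "A \<subseteq> X \<and> (\<exists>t\<in>A. (?L t \<in> V \<and> ?H t \<in> U) \<or> (?L t \<in> U \<and> ?H t \<in> V))"
    then obtain t where A: "A \<subseteq> X" and t: "t \<in> A"
      and cases: "(?L t \<in> V \<and> ?H t \<in> U) \<or> (?L t \<in> U \<and> ?H t \<in> V)" by blast
    \<comment> \<open>An element of \<open>?H t\<close> outside \<open>A\<close> lies above \<open>t\<close>, hence above every element of \<open>?L t\<close>;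
      so the product of \<open>?L t\<close> and \<open>?H t\<close>, in either order, stays inside \<open>A\<close>.\<close>
    have LH: "f x y \<in> A" if "x \<in> ?L t" "y \<in> ?H t" for x y
    proof (cases "y \<in> A")
      case True
      then have "x \<in> X" "y \<in> X" using that A by blast+
      then show ?thesis using lin' True that by force
    next
      case False
      then have "x \<in> X" "t \<in> X" "y \<in> X" "f x t = x" "f t y = t" using that A t by blast+
      then have "f x y = x" by (rule trans)
      then show ?thesis using that by simp
    qed
    have HL: "f y x \<in> A" if "x \<in> ?L t" "y \<in> ?H t" for x y
    proof -
      have "x \<in> X" "y \<in> X" using that A by blast+
      then show ?thesis using LH[OF that] com by metis
    qed
    from cases show ?l
      by (rule disjE; intro upfamily_multI[OF A]) (use LH HL in blast)+
  qed
qed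

lemma commutative_upfamilies_of_finite_chain:
  assumes "semilattice_on X f" "linear_on X f" "finite X"
  shows "commutative_on (upfamilies X) (upfamily_mult X f)"
  unfolding commutative_on_def
  using mem_chain_mult_iff[OF assms] by (auto intro!: set_eqI)

text \<open>
  Every subset of a linear semigroup is a subsemigroup, whence \<open>U \<subseteq> U * U\<close>. Conversely, the
  description of the product gives a subset of \<open>A\<close> that already belongs to \<open>U\<close>.
\<close>

lemma idempotent_upfamilies_of_finite_chain:
  assumes chain: "semilattice_on X f" "linear_on X f" "finite X" and U: "U \<in> upfamilies X"
  shows "upfamily_mult X f U U = U"
proof (rule set_eqI)
  fix A
  have mult: "A \<in> upfamily_mult X f U U \<longleftrightarrow> A \<subseteq> X \<and>
      (\<exists>t\<in>A. {x \<in> A. f x t = x} \<in> U \<and> A \<union> {x \<in> X. f t x = t} \<in> U)"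
    using mem_chain_mult_iff[OF chain U U] by simp
  show "A \<in> upfamily_mult X f U U \<longleftrightarrow> A \<in> U"
  proof
    assume "A \<in> upfamily_mult X f U U"
    then obtain t where "A \<subseteq> X" "{x \<in> A. f x t = x} \<in> U" using mult by blast
    then show "A \<in> U" using upfamilyD(4)[OF U, of _ A] by blast
  next
    assume A: "A \<in> U"
    have "f x y \<in> A" if "x \<in> A" "y \<in> A" for x y
    proof -
      have "x \<in> X" "y \<in> X" using that upfamilyD(3)[OF U A] by blast+
      then have "f x y \<in> {x, y}" using chain(2) unfolding linear_on_def by simp
      then show ?thesis using that by auto
    qed
    then show "A \<in> upfamily_mult X f U U"
      using A by (intro upfamily_multI[OF upfamilyD(3)[OF U A] A] bexI[of _ A]) auto
  qed
qed


section \<open>Maximal linked upfamilies\<close>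

lemma max_linked_subset_linked: "max_linked_upfamilies X \<subseteq> linked_upfamilies X"
  unfolding max_linked_upfamilies_def by blast

lemma linked_subset_upfamilies: "linked_upfamilies X \<subseteq> upfamilies X"
  unfolding linked_upfamilies_def by blast

lemmas linked_upfamilyD = linked_subset_upfamilies[THEN subsetD]
lemmas max_linked_linkedD = max_linked_subset_linked[THEN subsetD]
lemmas max_linked_upfamilyD = max_linked_linkedD[THEN linked_upfamilyD]

lemma commutative_on_subset:
  "commutative_on T f \<Longrightarrow> S \<subseteq> T \<Longrightarrow> commutative_on S f"
  unfolding commutative_on_def by blast

lemma linked_upfamiliesI:
  assumes "\<And>A. A \<in> F \<Longrightarrow> A \<subseteq> X" "F \<noteq> {}"
    and "\<And>A B. A \<in> F \<Longrightarrow> A \<subseteq> B \<Longrightarrow> B \<subseteq> X \<Longrightarrow> B \<in> F"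
    and "\<And>A B. A \<in> F \<Longrightarrow> B \<in> F \<Longrightarrow> \<exists>x. x \<in> A \<and> x \<in> B"
  shows "F \<in> linked_upfamilies X"
  unfolding linked_upfamilies_def upfamilies_def upfamily_on_def linked_def mem_Collect_eq
proof (intro conjI ballI allI impI)
  show "F \<noteq> {}" by fact
  show "A \<noteq> {}" "A \<subseteq> X" if "A \<in> F" for A
    using assms(1)[OF that] assms(4)[OF that that] by auto
  show "B \<in> F" if "A \<in> F \<and> A \<subseteq> B \<and> B \<subseteq> X" for A B
    using assms(3)[of A B] that by simp
  show "A \<inter> B \<noteq> {}" if "A \<in> F" "B \<in> F" for A B
    using assms(4)[OF that] by auto
qed

lemma linked_common_element:
  assumes "linked U" "{x \<in> X. P x} \<in> U" "{x \<in> X. Q x} \<in> U"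
  shows "\<exists>x\<in>X. P x \<and> Q x"
proof -
  have "{x \<in> X. P x} \<inter> {x \<in> X. Q x} \<noteq> {}"
    using assms unfolding linked_def by (elim ballE) auto
  then show ?thesis by blast
qed

text \<open>
  If \<open>A\<close> and \<open>B\<close> both belong to the product, linkedness of \<open>U\<close> gives a common \<open>x\<close> for which
  \<open>V\<close>-many \<open>y\<close> satisfy \<open>x y \<in> A\<close> and \<open>V\<close>-many satisfy \<open>x y \<in> B\<close>, and linkedness of \<open>V\<close> gives
  a common \<open>y\<close>.
\<close>

lemma linked_upfamily_mult:
  assumes U: "U \<in> linked_upfamilies X" and V: "V \<in> linked_upfamilies X"
  shows "linked (upfamily_mult X f U V)"
  unfolding linked_def
proof (intro ballI)
  fix A B assume A: "A \<in> upfamily_mult X f U V" and B: "B \<in> upfamily_mult X f U V"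
  have lU: "linked U" and lV: "linked V" using U V unfolding linked_upfamilies_def by auto
  have U': "U \<in> upfamilies X" and V': "V \<in> upfamilies X"
    using U V by (simp_all add: linked_upfamilyD)
  have "{x \<in> X. {y \<in> X. f x y \<in> A} \<in> V} \<in> U" "{x \<in> X. {y \<in> X. f x y \<in> B} \<in> V} \<in> U"
    using A B mem_upfamily_mult_iff[OF U' V'] by blast+
  then obtain x where "{y \<in> X. f x y \<in> A} \<in> V" "{y \<in> X. f x y \<in> B} \<in> V"
    using linked_common_element[OF lU, of X "\<lambda>x. {y \<in> X. f x y \<in> A} \<in> V"
        "\<lambda>x. {y \<in> X. f x y \<in> B} \<in> V"] by blast
  then show "A \<inter> B \<noteq> {}"
    using linked_common_element[OF lV, of X "\<lambda>y. f x y \<in> A" "\<lambda>y. f x y \<in> B"] by blast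
qed

lemma max_linkedI:
  assumes "F \<in> linked_upfamilies X"
    and "\<And>A. A \<subseteq> X \<Longrightarrow> (\<forall>B\<in>F. A \<inter> B \<noteq> {}) \<Longrightarrow> A \<in> F"
  shows "F \<in> max_linked_upfamilies X"
proof -
  have False if G: "G \<in> linked_upfamilies X" and FG: "F \<subset> G" for G
  proof -
    obtain A where A: "A \<in> G" "A \<notin> F" using FG by blast
    have "A \<subseteq> X" using A(1) upfamilyD(3)[OF linked_upfamilyD[OF G]] by simp
    moreover have "\<forall>B\<in>F. A \<inter> B \<noteq> {}"
      using A(1) G FG unfolding linked_upfamilies_def linked_def by blast
    ultimately show False using assms(2) A by blast
  qed
  then show ?thesis using assms(1) unfolding max_linked_upfamilies_def by blast
qed

text \<open>
  Linkedness involves only two members at a time, so it passes to unions of chains, and Zorn's lemma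
  applies. This is the source of the non-principal maximal linked upfamilies used to show that
  \<open>X\<close> is finite.
\<close>

lemma linked_extends_to_max_linked:
  assumes F: "F \<in> linked_upfamilies X"
  obtains G where "G \<in> max_linked_upfamilies X" "F \<subseteq> G"
proof -
  define P where "P = {G \<in> linked_upfamilies X. F \<subseteq> G}"
  have "\<exists>M\<in>P. \<forall>G\<in>P. M \<subseteq> G \<longrightarrow> G = M"
  proof (rule subset_Zorn_nonempty)
    show "P \<noteq> {}" using F unfolding P_def by blast
  next
    fix \<C> assume ne: "\<C> \<noteq> {}" and chain: "subset.chain P \<C>"
    have sub: "\<And>G. G \<in> \<C> \<Longrightarrow> G \<in> upfamilies X" "\<And>G. G \<in> \<C> \<Longrightarrow> linked G"
      "\<And>G. G \<in> \<C> \<Longrightarrow> F \<subseteq> G"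
      using chain unfolding subset_chain_def P_def linked_upfamilies_def by blast+
    have "\<Union>\<C> \<in> upfamilies X"
      unfolding upfamilies_def upfamily_on_def mem_Collect_eq
    proof (intro conjI)
      show "\<Union>\<C> \<noteq> {}" using ne sub(1) upfamilyD(1) by blast
      show "\<forall>A\<in>\<Union>\<C>. A \<noteq> {} \<and> A \<subseteq> X" using sub(1) upfamilyD(2,3) by blast
      show "\<forall>A B. A \<in> \<Union>\<C> \<and> A \<subseteq> B \<and> B \<subseteq> X \<longrightarrow> B \<in> \<Union>\<C>"
        using sub(1) upfamilyD(4) by blast
    qed
    moreover have "linked (\<Union>\<C>)"
      unfolding linked_def
    proof (intro ballI)
      fix A B assume "A \<in> \<Union>\<C>" "B \<in> \<Union>\<C>"
      then obtain G H where "G \<in> \<C>" "H \<in> \<C>" "A \<in> G" "B \<in> H" by blast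
      moreover from this have "G \<subseteq> H \<or> H \<subseteq> G"
        using chain unfolding subset_chain_def by blast
      ultimately show "A \<inter> B \<noteq> {}" using sub(2) unfolding linked_def by blast
    qed
    ultimately show "\<Union>\<C> \<in> P"
      using sub(3) ne unfolding P_def linked_upfamilies_def by blast
  qed
  then obtain M where M: "M \<in> P" "\<And>G. G \<in> P \<Longrightarrow> M \<subseteq> G \<Longrightarrow> G = M" by blast
  have "M \<in> max_linked_upfamilies X"
    using M unfolding P_def max_linked_upfamilies_def by blast
  then show thesis using M that unfolding P_def by blast
qed


section \<open>Commutativity of the base semigroup\<close>

definition principal :: "'a set \<Rightarrow> 'a \<Rightarrow> 'a set set" where
  "principal X x = {A. A \<subseteq> X \<and> x \<in> A}"

lemma principal_max_linked:
  assumes "x \<in> X"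
  shows "principal X x \<in> max_linked_upfamilies X"
proof (rule max_linkedI)
  show "principal X x \<in> linked_upfamilies X"
    by (rule linked_upfamiliesI) (use assms in \<open>auto simp: principal_def\<close>)
  fix A assume A: "A \<subseteq> X" "\<forall>B\<in>principal X x. A \<inter> B \<noteq> {}"
  have "{x} \<in> principal X x" using assms by (simp add: principal_def)
  with A(2) have "A \<inter> {x} \<noteq> {}" by (rule bspec)
  then show "A \<in> principal X x" using A(1) by (simp add: principal_def)
qed

lemmas principal_upfamily = principal_max_linked[THEN max_linked_upfamilyD]

lemma principal_mult:
  assumes "x \<in> X" "y \<in> X"
  shows "upfamily_mult X f (principal X x) (principal X y) = principal X (f x y)"
  using mem_upfamily_mult_iff[OF principal_upfamily[OF \<open>x \<in> X\<close>] principal_upfamily[OF \<open>y \<in> X\<close>]]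
    assms
  by (auto intro!: set_eqI simp: principal_def)

text \<open>
  The principal ultrafilters form a copy of \<open>X\<close> inside \<open>\<lambda>(X)\<close>.
\<close>

lemma commutative_of_max_linked:
  assumes clo: "\<And>x y. x \<in> X \<Longrightarrow> y \<in> X \<Longrightarrow> f x y \<in> X"
    and com: "commutative_on (max_linked_upfamilies X) (upfamily_mult X f)"
  shows "commutative_on X f"
  unfolding commutative_on_def
proof (intro ballI)
  fix x y assume xy: "x \<in> X" "y \<in> X"
  have "principal X (f x y) = principal X (f y x)"
    using com principal_max_linked xy principal_mult unfolding commutative_on_def by metis
  moreover have "{f x y} \<in> principal X (f x y)" using clo[OF xy] by (simp add: principal_def)
  ultimately have "{f x y} \<in> principal X (f y x)" by simp
  then show "f x y = f y x" by (simp add: principal_def)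
qed


section \<open>Linearity\<close>

text \<open>
  The sets containing at least two of three points. For distinct points this is the simplest maximal
  linked upfamily that is not an ultrafilter.
\<close>

definition majority :: "'a set \<Rightarrow> 'a \<Rightarrow> 'a \<Rightarrow> 'a \<Rightarrow> 'a set set" where
  "majority X x y z = {A. A \<subseteq> X \<and> (x \<in> A \<and> y \<in> A \<or> x \<in> A \<and> z \<in> A \<or> y \<in> A \<and> z \<in> A)}"

lemma majority_max_linked:
  assumes "x \<in> X" "y \<in> X" "z \<in> X"
  shows "majority X x y z \<in> max_linked_upfamilies X"
proof (rule max_linkedI)
  show "majority X x y z \<in> linked_upfamilies X"
  proof (rule linked_upfamiliesI)
    show "majority X x y z \<noteq> {}" using assms unfolding majority_def by blast
  qed (auto simp: majority_def)
  fix A assume A: "A \<subseteq> X" "\<forall>B\<in>majority X x y z. A \<inter> B \<noteq> {}"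
  have "{x, y} \<in> majority X x y z" "{x, z} \<in> majority X x y z" "{y, z} \<in> majority X x y z"
    using assms unfolding majority_def by auto
  then have "A \<inter> {x, y} \<noteq> {}" "A \<inter> {x, z} \<noteq> {}" "A \<inter> {y, z} \<noteq> {}" using A by blast+
  then show "A \<in> majority X x y z" using A(1) unfolding majority_def by blast
qed

lemma semilattice_not_linear_obtains:
  assumes "semilattice_on X f" "\<not> linear_on X f"
  obtains x y z where "x \<in> X" "y \<in> X" "z \<in> X" "x \<noteq> y" "x \<noteq> z" "y \<noteq> z"
    "f x y = z" "f y x = z" "f x z = z" "f z x = z" "f y z = z" "f z y = z"
    "f x x = x" "f y y = y" "f z z = z"
proof -
  have clo: "f x y \<in> X" if "x \<in> X" "y \<in> X" for x y
    using assms that unfolding semilattice_on_def band_on_def semigroup_on_def by blast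
  have com: "f x y = f y x" if "x \<in> X" "y \<in> X" for x y
    using assms that unfolding semilattice_on_def commutative_on_def by blast
  have assoc: "f (f x y) z = f x (f y z)" if "x \<in> X" "y \<in> X" "z \<in> X" for x y z
    using assms that unfolding semilattice_on_def band_on_def semigroup_on_def by blast
  have idem: "f x x = x" if "x \<in> X" for x
    using assms that unfolding semilattice_on_def band_on_def by blast
  obtain x y where xy: "x \<in> X" "y \<in> X" "f x y \<noteq> x" "f x y \<noteq> y"
    using assms(2) unfolding linear_on_def by blast
  define z where "z = f x y"
  have z: "z \<in> X" using clo xy unfolding z_def by blast
  have xz: "f x z = z" using assoc[of x x y] idem xy unfolding z_def by simp
  have zy: "f z y = z" using assoc[of x y y] idem xy unfolding z_def by simp
  show thesis
    by (rule that[of x y z])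
      (use xy z xz zy idem com[of x y] com[of x z] com[of y z] in \<open>auto simp: z_def[symmetric]\<close>)
qed

text \<open>
  Let \<open>V\<close> consist of all supersets of \<open>{x, y}\<close>. Multiplying \<open>x\<close> with \<open>{y, z}\<close> and \<open>y\<close> with
  \<open>{x, z}\<close> shows \<open>{z} \<in> V * M\<close> for the majority family \<open>M\<close>. But every member of \<open>M\<close> contains
  \<open>x\<close> or \<open>y\<close>, and neither of them multiplies all of \<open>{x, y}\<close> into \<open>{z}\<close>, so \<open>{z} \<notin> M * V\<close>.
\<close>

lemma linear_of_commutative_linked:
  assumes semil: "semilattice_on X f"
    and com: "commutative_on (linked_upfamilies X) (upfamily_mult X f)"
  shows "linear_on X f"
proof (rule ccontr)
  assume "\<not> linear_on X f"
  then obtain x y z where X: "x \<in> X" "y \<in> X" "z \<in> X" and ne: "x \<noteq> y" "x \<noteq> z" "y \<noteq> z"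
    and tab: "f x y = z" "f y x = z" "f x z = z" "f z x = z" "f y z = z" "f z y = z"
    "f x x = x" "f y y = y" "f z z = z"
    using semilattice_not_linear_obtains[OF semil] by metis
  define M where "M = majority X x y z"
  define V where "V = {A. {x, y} \<subseteq> A \<and> A \<subseteq> X}"
  have M_link: "M \<in> linked_upfamilies X"
    using max_linked_linkedD[OF majority_max_linked[OF X]] unfolding M_def .
  have V_link: "V \<in> linked_upfamilies X"
    by (rule linked_upfamiliesI) (use X in \<open>auto simp: V_def\<close>)
  have MV_up: "M \<in> upfamilies X" "V \<in> upfamilies X"
    using M_link V_link by (simp_all add: linked_upfamilyD)
  have "{z} \<in> upfamily_mult X f V M"
  proof (rule upfamily_multI)
    show "{z} \<subseteq> X" "{x, y} \<in> V" using X unfolding V_def by auto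
    fix u assume "u \<in> {x, y}"
    moreover have "{y, z} \<in> M" "{x, z} \<in> M" using X unfolding M_def majority_def by auto
    ultimately show "\<exists>C\<in>M. \<forall>v\<in>C. f u v \<in> {z}"
      using tab by (metis insert_iff singletonD)
  qed
  then have "{z} \<in> upfamily_mult X f M V" using com M_link V_link unfolding commutative_on_def by simp
  then have "{u \<in> X. {v \<in> X. f u v \<in> {z}} \<in> V} \<in> M"
    using mem_upfamily_mult_iff[OF MV_up] by blast
  then have "\<exists>u\<in>{x, y}. {v \<in> X. f u v \<in> {z}} \<in> V" unfolding M_def majority_def by blast
  then show False using tab ne unfolding V_def by auto
qed

text \<open>
  The majority family \<open>M\<close> of \<open>x, y, z\<close> satisfies \<open>{z} \<in> M * M\<close>, because \<open>x\<close> multiplies \<open>{y, z}\<close>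
  and \<open>y\<close> multiplies \<open>{x, z}\<close> into \<open>{z}\<close>. So \<open>M * M\<close> is the principal ultrafilter at \<open>z\<close>, and
  so is the cube because \<open>z\<close> is a zero of \<open>{x, y, z}\<close>; but \<open>M\<close> itself is not principal.
\<close>

lemma linear_of_clifford_max_linked:
  assumes semil: "semilattice_on X f"
    and cliff: "clifford12_on (max_linked_upfamilies X) (upfamily_mult X f)"
  shows "linear_on X f"
proof (rule ccontr)
  assume "\<not> linear_on X f"
  then obtain x y z where X: "x \<in> X" "y \<in> X" "z \<in> X" and ne: "x \<noteq> y" "x \<noteq> z" "y \<noteq> z"
    and tab: "f x y = z" "f y x = z" "f x z = z" "f z x = z" "f y z = z" "f z y = z"
    "f x x = x" "f y y = y" "f z z = z"
    using semilattice_not_linear_obtains[OF semil] by metis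
  define M where "M = majority X x y z"
  have M: "M \<in> max_linked_upfamilies X" using majority_max_linked[OF X] unfolding M_def .
  then have MU: "M \<in> upfamilies X" by (rule max_linked_upfamilyD)
  have pz: "principal X z \<in> upfamilies X" using principal_upfamily X(3) .
  \<comment> \<open>With these two rules every membership in a product becomes a propositional combination
    of statements about the products of \<open>x\<close>, \<open>y\<close> and \<open>z\<close>.\<close>
  have M_iff: "{u \<in> X. P u} \<in> M \<longleftrightarrow> P x \<and> P y \<or> P x \<and> P z \<or> P y \<and> P z" for P
    unfolding M_def majority_def using X by blast
  have p_iff: "{u \<in> X. P u} \<in> principal X z \<longleftrightarrow> P z" for P
    unfolding principal_def using X by blast
  have MM: "upfamily_mult X f M M = principal X z"
    unfolding set_eq_iff mem_upfamily_mult_iff[OF MU MU] M_iff tab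
    by (auto simp: principal_def)
  moreover have "upfamily_mult X f (principal X z) M = principal X z"
    unfolding set_eq_iff mem_upfamily_mult_iff[OF pz MU] M_iff p_iff tab
    by (auto simp: principal_def)
  ultimately have "M = principal X z" using cliff M unfolding clifford12_on_def by metis
  moreover have "{x, y} \<in> M" using X unfolding M_def majority_def by auto
  ultimately show False using ne unfolding principal_def by auto
qed


section \<open>Finiteness\<close>

lemma max_linked_containing_tails:
  assumes "\<And>n::nat. e n \<in> X"
  obtains U where "U \<in> max_linked_upfamilies X" "\<And>n. e ` {n..} \<in> U"
proof -
  define F where "F = {A. A \<subseteq> X \<and> (\<exists>n. e ` {n..} \<subseteq> A)}"
  have tail: "e ` {n..} \<in> F" for n using assms unfolding F_def by blast
  have "F \<in> linked_upfamilies X"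
  proof (rule linked_upfamiliesI)
    show "F \<noteq> {}" using tail by blast
    show "A \<subseteq> X" if "A \<in> F" for A using that unfolding F_def by simp
    show "B \<in> F" if "A \<in> F" "A \<subseteq> B" "B \<subseteq> X" for A B
      using that unfolding F_def mem_Collect_eq by (meson order_trans)
    fix A B assume "A \<in> F" "B \<in> F"
    then obtain m n where "e ` {m..} \<subseteq> A" "e ` {n..} \<subseteq> B" unfolding F_def by blast
    then have "e (max m n) \<in> A \<and> e (max m n) \<in> B" by auto
    then show "\<exists>x. x \<in> A \<and> x \<in> B" ..
  qed
  then obtain U where "U \<in> max_linked_upfamilies X" "F \<subseteq> U"
    using linked_extends_to_max_linked[of F X] by metis
  then show thesis using that tail by blast
qed

text \<open>
  Take maximal linked \<open>U\<close> and \<open>V\<close> containing all tails of \<open>e\<close> and of \<open>d\<close>. The tail of \<open>d\<close>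
  beyond index \<open>m\<close> is a member of \<open>V\<close> that \<open>e m\<close> multiplies into \<open>A\<close>, whence \<open>A \<in> U * V\<close>;
  likewise \<open>B \<in> V * U\<close>. Since \<open>U * V\<close> is linked, it cannot contain both of the disjoint sets
  \<open>A\<close> and \<open>B\<close>.
\<close>

lemma not_commutative_if_interleaved_sequences:
  fixes e d :: "nat \<Rightarrow> 'a"
  assumes e: "\<And>n. e n \<in> X" and d: "\<And>n. d n \<in> X"
    and AB: "A \<subseteq> X" "B \<subseteq> X" "A \<inter> B = {}"
    and ed: "\<And>m n. m < n \<Longrightarrow> f (e m) (d n) \<in> A"
    and de: "\<And>m n. m < n \<Longrightarrow> f (d m) (e n) \<in> B"
  shows "\<not> commutative_on (max_linked_upfamilies X) (upfamily_mult X f)"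
proof
  assume com: "commutative_on (max_linked_upfamilies X) (upfamily_mult X f)"
  obtain U where U: "U \<in> max_linked_upfamilies X" "\<And>n. e ` {n..} \<in> U"
    using max_linked_containing_tails[of e X, OF e] by metis
  obtain V where V: "V \<in> max_linked_upfamilies X" "\<And>n. d ` {n..} \<in> V"
    using max_linked_containing_tails[of d X, OF d] by metis
  have link: "U \<in> linked_upfamilies X" "V \<in> linked_upfamilies X"
    using U(1) V(1) by (simp_all add: max_linked_linkedD)
  then have up: "U \<in> upfamilies X" "V \<in> upfamilies X" by (simp_all add: linked_upfamilyD)
  have A: "A \<in> upfamily_mult X f U V"
  proof (rule upfamily_multI[OF AB(1) U(2)])
    fix x assume "x \<in> e ` {0..}"
    then obtain m where "x = e m" by blast
    then have "\<forall>y\<in>d ` {Suc m..}. f x y \<in> A" using ed by auto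
    then show "\<exists>C\<in>V. \<forall>y\<in>C. f x y \<in> A" using V(2) by blast
  qed
  have "B \<in> upfamily_mult X f V U"
  proof (rule upfamily_multI[OF AB(2) V(2)])
    fix x assume "x \<in> d ` {0..}"
    then obtain m where "x = d m" by blast
    then have "\<forall>y\<in>e ` {Suc m..}. f x y \<in> B" using de by auto
    then show "\<exists>C\<in>U. \<forall>y\<in>C. f x y \<in> B" using U(2) by blast
  qed
  then have "B \<in> upfamily_mult X f U V" using com U V unfolding commutative_on_def by simp
  then show False using linked_upfamily_mult[OF link, of f] A AB(3) unfolding linked_def by blast
qed

text \<open>
  Ramsey's theorem: colour a pair of indices according to whether the product of the two terms is the
  earlier or the later one, and pass to a homogeneous subsequence.
\<close>

lemma infinite_linear_has_monotone_sequence: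
  assumes lin: "linear_on X f" and inf: "infinite X"
  obtains s :: "nat \<Rightarrow> 'a" where "inj s" "range s \<subseteq> X"
    "(\<forall>m n. m < n \<longrightarrow> f (s m) (s n) = s m) \<or> (\<forall>m n. m < n \<longrightarrow> f (s m) (s n) = s n)"
proof -
  obtain t :: "nat \<Rightarrow> 'a" where t: "inj t" "range t \<subseteq> X"
    using infinite_countable_subset[OF inf] by blast
  define c where
    "c P = (if f (t (Min P)) (t (Max P)) = t (Min P) then 0 else 1::nat)" for P :: "nat set"
  have "\<exists>Y k. Y \<subseteq> UNIV \<and> infinite Y \<and> k < 2 \<and> (\<forall>x\<in>Y. \<forall>y\<in>Y. x \<noteq> y \<longrightarrow> c {x, y} = k)"
    by (rule Ramsey2) (auto simp: c_def)
  then obtain Y k where Y: "infinite Y" and k: "\<And>x y. x \<in> Y \<Longrightarrow> y \<in> Y \<Longrightarrow> x \<noteq> y \<Longrightarrow> c {x, y} = k"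
    by metis
  have mono: "strict_mono (enumerate Y)" using strict_mono_enumerate[OF Y] .
  define s where "s n = t (enumerate Y n)" for n
  have ck: "k = (if f (s m) (s n) = s m then 0 else 1)" if "m < n" for m n
  proof -
    have less: "enumerate Y m < enumerate Y n" using mono that unfolding strict_mono_def by blast
    have "c {enumerate Y m, enumerate Y n} = k"
      using k enumerate_in_set[OF Y] less by (metis less_irrefl)
    then show ?thesis using less unfolding c_def s_def by (simp add: min_def max_def)
  qed
  have sX: "s n \<in> X" for n using t unfolding s_def by blast
  have other: "f (s m) (s n) = s n" if "f (s m) (s n) \<noteq> s m" for m n
    using lin sX that unfolding linear_on_def by blast
  have "(\<forall>m n. m < n \<longrightarrow> f (s m) (s n) = s m) \<or> (\<forall>m n. m < n \<longrightarrow> f (s m) (s n) = s n)"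
  proof (cases "k = 0")
    case True
    then show ?thesis using ck by (metis zero_neq_one)
  next
    case False
    then show ?thesis using ck other by metis
  qed
  moreover have "inj s"
    using t(1) strict_mono_imp_inj_on[OF mono] unfolding s_def inj_def by blast
  ultimately show thesis using that sX by blast
qed

text \<open>
  The even and the odd terms of a monotone sequence are interleaved, so a mixed product \<open>e m * d n\<close>
  with \<open>m < n\<close> always falls into the same one of the two subsequences, and a mixed product
  \<open>d m * e n\<close> into the other one.
\<close>

lemma finite_of_commutative_max_linked:
  assumes lin: "linear_on X f"
    and com: "commutative_on (max_linked_upfamilies X) (upfamily_mult X f)"
  shows "finite X"
proof (rule ccontr)
  assume inf: "infinite X"
  obtain s :: "nat \<Rightarrow> 'a" where s: "inj s" "range s \<subseteq> X"
    and mono: "(\<forall>m n. m < n \<longrightarrow> f (s m) (s n) = s m) \<or> (\<forall>m n. m < n \<longrightarrow> f (s m) (s n) = s n)"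
    using infinite_linear_has_monotone_sequence[OF lin inf] .
  define e d where "e n = s (2 * n)" and "d n = s (2 * n + 1)" for n
  have eX: "e n \<in> X" and dX: "d n \<in> X" for n using s unfolding e_def d_def by auto
  have sub: "range e \<subseteq> X" "range d \<subseteq> X" using eX dX by auto
  have "e m \<noteq> d n" for m n
  proof -
    have "2 * m \<noteq> 2 * n + 1" by presburger
    then show ?thesis using s(1) unfolding e_def d_def inj_def by blast
  qed
  then have disj: "range e \<inter> range d = {}" "range d \<inter> range e = {}" by (auto, metis)
  from mono show False
  proof
    assume "\<forall>m n. m < n \<longrightarrow> f (s m) (s n) = s m"
    then have "f (e m) (d n) = e m" "f (d m) (e n) = d m" if "m < n" for m n
      using that unfolding e_def d_def by simp_all
    then show False
      using not_commutative_if_interleaved_sequences[of e X d "range e" "range d" f] eX dX sub disj com by simp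
  next
    assume "\<forall>m n. m < n \<longrightarrow> f (s m) (s n) = s n"
    then have "f (e m) (d n) = d n" "f (d m) (e n) = e n" if "m < n" for m n
      using that unfolding e_def d_def by simp_all
    then show False
      using not_commutative_if_interleaved_sequences[of e X d "range d" "range e" f] eX dX sub disj com by simp
  qed
qed


section \<open>The characterization\<close>

theorem theorem2p6:
  fixes X :: "'a set" and f :: "'a \<Rightarrow> 'a \<Rightarrow> 'a"
  assumes "band_on X f"
  shows "((finite X \<and> linear_on X f \<and> semilattice_on X f) \<longleftrightarrow>
            commutative_on (upfamilies X) (upfamily_mult X f)) \<and>
         (commutative_on (upfamilies X) (upfamily_mult X f) \<longleftrightarrow>
            commutative_on (linked_upfamilies X) (upfamily_mult X f)) \<and>
         (commutative_on (linked_upfamilies X) (upfamily_mult X f) \<longleftrightarrow>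
            commutative_on (max_linked_upfamilies X) (upfamily_mult X f) \<and>
            clifford12_on (max_linked_upfamilies X) (upfamily_mult X f))"
    (is "(?chain \<longleftrightarrow> ?up) \<and> (?up \<longleftrightarrow> ?link) \<and> (?link \<longleftrightarrow> ?max \<and> ?cliff)")
proof -
  have clo: "f x y \<in> X" if "x \<in> X" "y \<in> X" for x y
    using assms that unfolding band_on_def semigroup_on_def by blast
  have semil: "semilattice_on X f" if ?max
    using commutative_of_max_linked[OF clo that] assms unfolding semilattice_on_def by blast
  have chain_up: ?up if ?chain
    using that commutative_upfamilies_of_finite_chain by blast
  have up_link: ?link if ?up
    using that commutative_on_subset linked_subset_upfamilies by blast
  have link_max: ?max if ?link
    using that commutative_on_subset max_linked_subset_linked by blast
  have link_chain: ?chain if ?link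
    using semil linear_of_commutative_linked finite_of_commutative_max_linked link_max that
    by blast
  have max_chain: ?chain if ?max ?cliff
    using semil linear_of_clifford_max_linked finite_of_commutative_max_linked that by blast
  have chain_cliff: ?cliff if ?chain
    unfolding clifford12_on_def
    using that idempotent_upfamilies_of_finite_chain[of X f]
      max_linked_subset_linked[of X] linked_subset_upfamilies[of X] by blast
  show ?thesis
    using chain_up up_link link_max link_chain max_chain chain_cliff by blast
qed

end
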